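(* For every integer $k$ with $8\le k\le 13$, there exists $\theta\in\mathbb{R}/2\pi\mathbb{Z}$ with $\sin 2\theta\ne 0$ and $\sin\theta\neq\cos\theta$ such that $$E_f(C_\theta)<E_f(C_{D_4})$$ when $f(t)=(1+t)^k$. For every other nonnegative integer $k$, no such $\theta$ exists.
   Context: For a function $f\colon[-1,1)\to\mathbb{R}$ and a finite subset $C$ of the unit sphere $S^3\subset\mathbb{R}^4$, the energy is $$E_f(C)=\sum_{c,c'\in C,\ c\neq c'} f\big(\langle c,c'\rangle\big),$$ the sum being over ordered pairs of distinct points, with $\langle\cdot,\cdot\rangle$ the usual inner product on $\mathbb{R}^4$. $C_{D_4}\subset S^3$ is the set of $24$ normalized roots of the $D_4$ root system (the vertices of the regular $24$-cell); up to an orthogonal transformation, $C_{D_4}=\{(\pm e_i\pm e_j)/\sqrt{2}:1\le i<j\le 4\}$ (all choices of signs), where $e_1,\dots,e_4$ is the standard basis of $\mathbb{R}^4$. Identify $\mathbb{R}^4$ with $\mathbb{C}^2$, so that $S^3=\{(w_1,w_2)\in\mathbb{C}^2:|w_1|^2+|w_2|^2=1\}$ and the inner product is $\langle(z_1,z_2),(\zeta_1,\zeta_2)\rangle=\operatorname{Re}(z_1\overline{\zeta_1}+z_2\overline{\zeta_2})$. For $\theta\in\mathbb{R}/2\pi\mathbb{Z}$ with $\sin2\theta\neq0$ and $\sin\theta\neq\cos\theta$, define the $24$-point code $$C_\theta=\{(z,0),\,(0,w),\,(z\sin\theta,w\cos\theta),\,(z\cos\theta,w\sin\theta): z,w\in\mathbb{C},\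 z^3=w^3=1\}\subset S^3.$$ *)

theory Defs
  imports "HOL-Analysis.Analysis"
begin

text \<open>The potential only matters on \<open>{-1..<1}\<close>: for distinct unit vectors the inner product lies
  in that interval.\<close>

definition energy :: "(real \<Rightarrow> real) \<Rightarrow> (real ^ 4) set \<Rightarrow> real" where
  "energy f C = (\<Sum>(c, c') \<in> {(c, c'). c \<in> C \<and> c' \<in> C \<and> c \<noteq> c'}. f (c \<bullet> c'))"

text \<open>The index type \<open>4\<close> is linearly ordered as \<open>0 < 1 < 2 < 3\<close> (with \<open>4 = 0\<close>), so \<open>i < j\<close>
  runs through all six unordered pairs of distinct indices.\<close>

definition C_D4 :: "(real ^ 4) set" where
  "C_D4 = {(s *\<^sub>R axis i 1 + t *\<^sub>R axis j 1) /\<^sub>R sqrt 2 | (i :: 4) (j :: 4) s t.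
             i < j \<and> s \<in> {-1, 1} \<and> t \<in> {-1, 1}}"

definition of_C2 :: "complex \<times> complex \<Rightarrow> real ^ 4" where
  "of_C2 p = (\<chi> i. if i = 1 then Re (fst p) else if i = 2 then Im (fst p)
                  else if i = 3 then Re (snd p) else Im (snd p))"

lemma inner_of_C2:
  "of_C2 (z1, z2) \<bullet> of_C2 (\<zeta>1, \<zeta>2) = Re (z1 * cnj \<zeta>1 + z2 * cnj \<zeta>2)"
  by (simp add: of_C2_def inner_vec_def sum_4)

definition C_theta :: "real \<Rightarrow> (real ^ 4) set" where
  "C_theta \<theta> = of_C2 `
     ({(z, 0) | z. z ^ 3 = 1} \<union>
      {(0, w) | w. w ^ 3 = 1} \<union>
      {(z * of_real (sin \<theta>), w * of_real (cos \<theta>)) | z w. z ^ 3 = 1 \<and> w ^ 3 = 1} \<union>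
      {(z * of_real (cos \<theta>), w * of_real (sin \<theta>)) | z w. z ^ 3 = 1 \<and> w ^ 3 = 1})"

end

theory Submission
  imports Defs
begin

text \<open>
  Throughout, \<open>s = sin \<theta>\<close>, \<open>c = cos \<theta>\<close> and \<open>p = s + c\<close>.

  Exchanging \<open>s\<close> and \<open>c\<close> only permutes the inner products between points of \<open>C_theta \<theta>\<close>.
  Hence for \<open>f t = (1 + t) ^ k\<close> the energy is a symmetric polynomial in \<open>s\<close> and \<open>c\<close>, and
  since \<open>2 * s * c = p\<^sup>2 - 1\<close> it is a polynomial in \<open>p\<close> alone. After multiplication by
  \<open>4 ^ k\<close> it has integer coefficients (\<open>poly_val_energy_poly\<close>). For a fixed \<open>k\<close>,
  comparing with the 24-cell therefore means determining the sign of one explicit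
  integer polynomial, the gap, in \<open>p \<in> [-sqrt 2, sqrt 2]\<close> (\<open>poly_val_gap_poly\<close>).

  For \<open>k \<le> 2\<close> the gap is zero, for \<open>k = 3\<close> it is \<open>72 * (2 + 9 * p - 3 * p ^ 3)\<^sup>2\<close>, and for
  \<open>4 \<le> k \<le> 7\<close> and \<open>k = 14\<close> it is nonnegative. For \<open>8 \<le> k \<le> 13\<close> it is negative at
  \<open>p = -1/4\<close>. The case \<open>k = 14\<close> is the delicate one: near \<open>p = -0.26\<close> the gap drops to
  about \<open>0.00015\<close> of the energy. Nonnegativity is decided by bisection, where on each piece
  a lower bound is read off from the coefficients (\<open>nonneg_by_bisection_sound\<close>).

  All \<open>k > 14\<close> follow from two facts. Distinct points of the 24-cell have
  inner product at most \<open>1/2\<close>, so its energy grows at most by the factor \<open>3/2\<close>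
  from \<open>k\<close> to \<open>k + 1\<close> (\<open>energy_C_D4_Suc_le\<close>). For any code, once the energy has grown by
  a factor \<open>r\<close> at one exponent, it does so at all later ones (\<open>energy_growth\<close>), because the
  terms with \<open>1 + t > r\<close> gain weight relative to the others. So it is enough to
  check that the energy of \<open>C_theta \<theta>\<close> grows by \<open>3/2\<close> from \<open>k = 14\<close> to \<open>k = 15\<close>, which is
  again the nonnegativity of one polynomial in \<open>p\<close>.
\<close>

section \<open>Energy as a double sum\<close>

text \<open>Including the diagonal turns the energy into an iterated sum over the same set, which can be
  evaluated one orbit of points at a time.\<close>

lemma energy_eq_double_sum:
  assumes "finite C"
  shows "energy f C = (\<Sum>x\<in>C. \<Sum>y\<in>C. f (x \<bullet> y)) - (\<Sum>x\<in>C. f (x \<bullet> x))"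
proof -
  have "(\<Sum>x\<in>C. \<Sum>y\<in>C. f (x \<bullet> y)) = (\<Sum>x\<in>C. f (x \<bullet> x) + (\<Sum>y\<in>C - {x}. f (x \<bullet> y)))"
    using assms by (intro sum.cong refl) (simp add: sum.remove)
  also have "\<dots> = (\<Sum>x\<in>C. f (x \<bullet> x)) + (\<Sum>x\<in>C. \<Sum>y\<in>C - {x}. f (x \<bullet> y))"
    by (rule sum.distrib)
  also have "(\<Sum>x\<in>C. \<Sum>y\<in>C - {x}. f (x \<bullet> y)) = (\<Sum>(x, y)\<in>Sigma C (\<lambda>x. C - {x}). f (x \<bullet> y))"
    using assms by (subst sum.Sigma) auto
  also have "Sigma C (\<lambda>x. C - {x}) = {(x, y). x \<in> C \<and> y \<in> C \<and> x \<noteq> y}"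
    by auto
  finally show ?thesis by (simp add: energy_def)
qed

section \<open>The energy of the 24-cell\<close>

definition root_vec :: "4 \<Rightarrow> 4 \<Rightarrow> real \<Rightarrow> real \<Rightarrow> real ^ 4" where
  "root_vec i j s t = (s *\<^sub>R axis i 1 + t *\<^sub>R axis j 1) /\<^sub>R sqrt 2"

definition index_pairs :: "(4 \<times> 4) set" where
  "index_pairs = {(i, j). i < j}"

lemma index_pairs_eq: "index_pairs = {(0, 1), (0, 2), (0, 3), (1, 2), (1, 3), (2, 3)}"
proof -
  have four: "i = 0 \<or> i = 1 \<or> i = 2 \<or> i = 3" for i :: 4
    using exhaust_4[of i] by auto
  have "(i, j) \<in> index_pairs \<longleftrightarrow> (i, j) \<in> {(0, 1), (0, 2), (0, 3), (1, 2), (1, 3), (2, 3)}" for i j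
    using four[of i] four[of j] unfolding index_pairs_def
    \<comment> \<open>The order on \<open>4\<close> is that of the representatives modulo four, hence the \<open>Rep\<close> rules.\<close>
    by (elim disjE) (simp_all add: less_bit0_def bit0.Rep_numeral bit0.Rep_0 bit0.Rep_1)
  thus ?thesis by (intro set_eqI) (simp only: split_paired_all)
qed

lemma inner_root_vec:
  "root_vec i j s t \<bullet> root_vec i' j' s' t' =
     ((if i = i' then s * s' else 0) + (if i = j' then s * t' else 0)
    + (if j = i' then t * s' else 0) + (if j = j' then t * t' else 0)) / 2"
  by (simp add: root_vec_def inner_add_left inner_add_right inner_axis_axis field_simps)

lemma C_D4_eq:
  "C_D4 = (\<lambda>((i, j), s, t). root_vec i j s t) ` (index_pairs \<times> {-1, 1} \<times> {-1, 1})"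
proof (intro set_eqI iffI)
  fix x assume "x \<in> C_D4"
  then obtain i j s t where "i < j" "s \<in> {-1, 1}" "t \<in> {-1, 1}" "x = root_vec i j s t"
    unfolding C_D4_def root_vec_def by blast
  thus "x \<in> (\<lambda>((i, j), s, t). root_vec i j s t) ` (index_pairs \<times> {-1, 1} \<times> {-1, 1})"
    by (intro image_eqI[of _ _ "((i, j), s, t)"]) (auto simp: index_pairs_def)
next
  fix x assume "x \<in> (\<lambda>((i, j), s, t). root_vec i j s t) ` (index_pairs \<times> {-1, 1} \<times> {-1, 1})"
  then obtain i j s t where "i < j" "s \<in> {-1, 1}" "t \<in> {-1, 1}" "x = root_vec i j s t"
    unfolding index_pairs_def by (elim imageE SigmaE) auto
  thus "x \<in> C_D4"
    unfolding C_D4_def root_vec_def by blast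
qed

lemma inj_on_root_vec:
  "inj_on (\<lambda>((i, j), s, t). root_vec i j s t) (index_pairs \<times> {-1, 1} \<times> {-1, 1 :: real})"
proof -
  have *: "i = i' \<and> j = j' \<and> s = s' \<and> t = t'"
    if ij: "(i, j) \<in> index_pairs" "(i', j') \<in> index_pairs"
    and st: "s \<in> {-1, 1}" "t \<in> {-1, 1}" "s' \<in> {-1, 1}" "t' \<in> {-1, 1 :: real}"
    and eq: "root_vec i j s t = root_vec i' j' s' t'" for i j s t i' j' s' t'
  proof -
    have lt: "i < j" "i' < j'" using ij by (auto simp: index_pairs_def)
    have comp: "root_vec i j s t $ m = (if m = i then s else if m = j then t else 0) / sqrt 2"
      if "i < j" for i j s t m
      using that by (auto simp: root_vec_def axis_def field_simps)
    have "(if m = i then s else if m = j then t else 0) = (if m = i' then s' else if m = j' then t' else 0)" for m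
      using arg_cong[OF eq, of "\<lambda>v. v $ m"] comp lt by simp
    note this[of i] this[of j] this[of i'] this[of j']
    thus ?thesis
      using st lt by (auto split: if_splits)
  qed
  show ?thesis
    by (rule inj_onI)
      (use * in \<open>clarsimp simp only: mem_Sigma_iff prod.case split_paired_all prod.inject; metis\<close>)
qed

lemma sum_C_D4:
  "finite C_D4"
  "(\<Sum>x\<in>C_D4. G x) = (\<Sum>(i, j)\<in>index_pairs. \<Sum>s\<in>{-1, 1}. \<Sum>t\<in>{-1, 1}. G (root_vec i j s t))"
proof -
  show "finite C_D4" unfolding C_D4_eq index_pairs_eq by simp
  show "(\<Sum>x\<in>C_D4. G x) = (\<Sum>(i, j)\<in>index_pairs. \<Sum>s\<in>{-1, 1}. \<Sum>t\<in>{-1, 1}. G (root_vec i j s t))"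
    unfolding C_D4_eq by (subst sum.reindex[OF inj_on_root_vec])
      (simp add: sum.cartesian_product case_prod_unfold del: sum.insert)
qed

text \<open>Every root sees the others in the same way: one antipode, eight roots at inner product
  \<open>1/2\<close>, eight at \<open>-1/2\<close> and six orthogonal ones.\<close>

lemma energy_C_D4:
  "energy f C_D4 = 24 * (f (-1) + 8 * f (-1/2) + 6 * f 0 + 8 * f (1/2))"
proof -
  have row: "(\<Sum>x\<in>C_D4. f (x \<bullet> root_vec i j s t)) = f 1 + f (-1) + 8 * f (-1/2) + 6 * f 0 + 8 * f (1/2)"
    if "(i, j) \<in> index_pairs" "s \<in> {-1, 1}" "t \<in> {-1, 1}" for i j s t
    using that unfolding sum_C_D4(2) inner_root_vec unfolding index_pairs_eq
    by auto
  have "(\<Sum>y\<in>C_D4. \<Sum>x\<in>C_D4. f (x \<bullet> y)) =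
      (\<Sum>(i, j)\<in>index_pairs. \<Sum>s\<in>{-1, 1 :: real}. \<Sum>t\<in>{-1, 1 :: real}.
         f 1 + f (-1) + 8 * f (-1/2) + 6 * f 0 + 8 * f (1/2))"
    unfolding sum_C_D4(2)[of "\<lambda>y. \<Sum>x\<in>C_D4. f (x \<bullet> y)"]
    using row by (intro sum.cong refl)
      (simp only: split_paired_all prod.case, intro sum.cong refl, blast)
  also have "\<dots> = 24 * (f 1 + f (-1) + 8 * f (-1/2) + 6 * f 0 + 8 * f (1/2))"
    unfolding index_pairs_eq by simp
  finally have double: "(\<Sum>x\<in>C_D4. \<Sum>y\<in>C_D4. f (x \<bullet> y)) =
      24 * (f 1 + f (-1) + 8 * f (-1/2) + 6 * f 0 + 8 * f (1/2))"
    by (subst sum.swap)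
  have "(\<Sum>x\<in>C_D4. f (x \<bullet> x)) = 24 * f 1"
    unfolding sum_C_D4(2) inner_root_vec unfolding index_pairs_eq by simp
  thus ?thesis
    unfolding energy_eq_double_sum[OF sum_C_D4(1)] double by simp
qed

section \<open>The energy of the competing codes\<close>

abbreviation cube_roots :: "complex set" where
  "cube_roots \<equiv> {z. z ^ 3 = 1}"

lemma cube_roots_eq:
  "cube_roots = {1, Complex (-1/2) (sqrt 3 / 2), Complex (-1/2) (- sqrt 3 / 2)}" (is "_ = {1, ?w, ?v}")
proof -
  have "z ^ 3 - 1 = (z - 1) * ((z - ?w) * (z - ?v))" for z
  proof -
    have "(z - ?w) * (z - ?v) = z\<^sup>2 - z * (?w + ?v) + ?w * ?v"
      by (simp add: algebra_simps power2_eq_square)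
    also have "?w + ?v = -1" by (simp add: complex_eq_iff)
    also have "?w * ?v = 1" by (simp add: complex_eq_iff)
    finally show ?thesis by (simp add: algebra_simps power2_eq_square power3_eq_cube)
  qed
  hence "z ^ 3 = 1 \<longleftrightarrow> z = 1 \<or> z = ?w \<or> z = ?v" for z
    by (metis eq_iff_diff_eq_0 mult_eq_0_iff)
  thus ?thesis by auto
qed

lemma finite_cube_roots [simp]: "finite cube_roots"
  by (simp add: cube_roots_eq)

lemma card_cube_roots: "card cube_roots = 3"
  unfolding cube_roots_eq by (simp add: complex_eq_iff)

text \<open>Multiplication by \<open>cnj z'\<close> permutes the cube roots of unity, whose real parts are
  \<open>1\<close>, \<open>-1/2\<close> and \<open>-1/2\<close>.\<close>

lemma sum_cube_roots:
  fixes g :: "real \<Rightarrow> real"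
  assumes "z' ^ 3 = 1"
  shows "(\<Sum>z\<in>cube_roots. g (Re (z * cnj z'))) = g 1 + 2 * g (-1/2)"
proof -
  have "z' \<in> cube_roots" using assms by simp
  moreover have "(\<Sum>z\<in>cube_roots. h z) =
      h 1 + h (Complex (-1/2) (sqrt 3 / 2)) + h (Complex (-1/2) (- sqrt 3 / 2))" for h :: "complex \<Rightarrow> real"
    unfolding cube_roots_eq by (simp add: complex_eq_iff)
  ultimately show ?thesis
    unfolding cube_roots_eq by (elim insertE emptyE; hypsubst; simp)
qed

lemma cube_root_mult_cnj: "z ^ 3 = 1 \<Longrightarrow> z * cnj z = 1" for z :: complex
  by (metis complex_norm_square mult.right_neutral norm_one of_real_1 one_power2
      power_eq_1_iff zero_neq_numeral)

text \<open>\<open>C_theta \<theta>\<close> consists of orbits of points \<open>(a, b)\<close> under the group of pairs of cube roots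
  of unity. If \<open>a\<close> or \<open>b\<close> vanishes, this sum counts every point of the orbit three times.\<close>

definition torus_sum :: "real \<Rightarrow> real \<Rightarrow> (real ^ 4 \<Rightarrow> real) \<Rightarrow> real" where
  "torus_sum a b G =
     (\<Sum>z\<in>cube_roots. \<Sum>w\<in>cube_roots. G (of_C2 (z * of_real a, w * of_real b)))"

text \<open>The value does not depend on \<open>z'\<close> and \<open>w'\<close>, so that a double sum over two orbits is nine
  times this expression.\<close>

lemma torus_sum_inner:
  assumes "z' ^ 3 = 1" "w' ^ 3 = 1"
  shows "torus_sum a b (\<lambda>x. F (x \<bullet> of_C2 (z' * of_real a', w' * of_real b'))) =
    F (a * a' + b * b') + 2 * F (a * a' - b * b' / 2) + 2 * F (b * b' - a * a' / 2)
      + 4 * F (- (a * a' + b * b') / 2)"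
proof -
  have inn: "of_C2 (z * of_real a, w * of_real b) \<bullet> of_C2 (z' * of_real a', w' * of_real b') =
      a * a' * Re (z * cnj z') + b * b' * Re (w * cnj w')" for z w
    by (simp add: inner_of_C2 algebra_simps)
  have "torus_sum a b (\<lambda>x. F (x \<bullet> of_C2 (z' * of_real a', w' * of_real b'))) =
    (\<Sum>z\<in>cube_roots. F (a * a' * Re (z * cnj z') + b * b')
       + 2 * F (a * a' * Re (z * cnj z') - b * b' / 2))"
    unfolding torus_sum_def inn
    using sum_cube_roots[OF assms(2), of "\<lambda>t. F (a * a' * Re (z * cnj z') + b * b' * t)" for z]
    by (intro sum.cong refl) simp
  also have "\<dots> = F (a * a' + b * b') + 2 * F (a * a' - b * b' / 2) +
      2 * (F (b * b' - a * a' / 2) + 2 * F (- (a * a' + b * b') / 2))"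
    using sum_cube_roots[OF assms(1), of "\<lambda>t. F (a * a' * t + b * b') + 2 * F (a * a' * t - b * b' / 2)"]
    by (simp add: field_simps)
  finally show ?thesis by simp
qed

lemma torus_sum_const:
  assumes "\<And>z w. z ^ 3 = 1 \<Longrightarrow> w ^ 3 = 1 \<Longrightarrow> G (of_C2 (z * of_real a, w * of_real b)) = v"
  shows "torus_sum a b G = 9 * v"
proof -
  have "torus_sum a b G = (\<Sum>z\<in>cube_roots. \<Sum>w\<in>cube_roots. v)"
    unfolding torus_sum_def using assms by (intro sum.cong refl) auto
  thus ?thesis by (simp add: card_cube_roots)
qed

lemma inj_of_C2: "inj of_C2"
proof (rule injI)
  fix p q assume eq: "of_C2 p = of_C2 q"
  have "of_C2 p $ i = of_C2 q $ i" for i using eq by simp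
  from this[of 1] this[of 2] this[of 3] this[of 4] show "p = q"
    by (simp add: of_C2_def prod_eq_iff complex_eq_iff)
qed

lemma torus_point_inner_self:
  assumes "z ^ 3 = 1" "w ^ 3 = 1"
  shows "of_C2 (z * of_real a, w * of_real b) \<bullet> of_C2 (z * of_real a, w * of_real b) = a\<^sup>2 + b\<^sup>2"
proof -
  have "z * of_real a * cnj (z * of_real a) + w * of_real b * cnj (w * of_real b) =
      (z * cnj z) * of_real (a\<^sup>2) + (w * cnj w) * of_real (b\<^sup>2)"
    by (simp add: power2_eq_square)
  thus ?thesis using assms by (simp add: inner_of_C2 cube_root_mult_cnj)
qed

lemma C_theta_unit:
  assumes "x \<in> C_theta \<theta>"
  shows "x \<bullet> x = 1"
proof -
  have "\<exists>z w a b. z ^ 3 = 1 \<and> w ^ 3 = 1 \<and> a\<^sup>2 + b\<^sup>2 = (1 :: real) \<and>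
      x = of_C2 (z * of_real a, w * of_real b)"
    using assms sin_cos_squared_add[of \<theta>] sin_cos_squared_add2[of \<theta>]
    unfolding C_theta_def
    apply (elim imageE UnE CollectE exE conjE)
    subgoal for p z by (intro exI[of _ z] exI[of _ 1] exI[of _ 1] exI[of _ 0]) simp
    subgoal for p w by (intro exI[of _ 1] exI[of _ w] exI[of _ 0] exI[of _ 1]) simp
    subgoal for p z w by (intro exI[of _ z] exI[of _ w] exI[of _ "sin \<theta>"] exI[of _ "cos \<theta>"]) simp
    subgoal for p z w by (intro exI[of _ z] exI[of _ w] exI[of _ "cos \<theta>"] exI[of _ "sin \<theta>"]) simp
    done
  thus ?thesis using torus_point_inner_self by metis
qed

context
  fixes \<theta> :: real
  assumes sin2: "sin (2 * \<theta>) \<noteq> 0" and neq: "sin \<theta> \<noteq> cos \<theta>"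
begin

text \<open>The hypotheses on \<open>\<theta>\<close> make the four orbits disjoint: \<open>z * sin \<theta> = z' * cos \<theta>\<close> with cube
  roots of unity \<open>z\<close>, \<open>z'\<close> gives \<open>(sin \<theta>) ^ 3 = (cos \<theta>) ^ 3\<close>, hence \<open>sin \<theta> = cos \<theta>\<close>. The
  divisions by three correct the multiplicity in the two degenerate orbits.\<close>

lemma sum_C_theta:
  "finite (C_theta \<theta>)"
  "(\<Sum>x\<in>C_theta \<theta>. G x) =
     torus_sum 1 0 G / 3 + torus_sum 0 1 G / 3
       + torus_sum (sin \<theta>) (cos \<theta>) G + torus_sum (cos \<theta>) (sin \<theta>) G"
proof -
  define s c where "s = complex_of_real (sin \<theta>)" and "c = complex_of_real (cos \<theta>)"
  have s0: "s \<noteq> 0" and c0: "c \<noteq> 0" using sin2 by (auto simp: s_def c_def sin_double)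
  have "sin \<theta> ^ 3 \<noteq> cos \<theta> ^ 3" using neq
    by (metis odd_numeral odd_real_root_unique numeral_3_eq_3 odd_real_root_power_cancel)
  hence sc: "s ^ 3 \<noteq> c ^ 3" unfolding s_def c_def by (metis of_real_eq_iff of_real_power)
  let ?A = "(\<lambda>z. (z, 0 :: complex)) ` cube_roots"
  let ?B = "(\<lambda>w. (0 :: complex, w)) ` cube_roots"
  let ?P = "(\<lambda>(z, w). (z * s, w * c)) ` (cube_roots \<times> cube_roots)"
  let ?Q = "(\<lambda>(z, w). (z * c, w * s)) ` (cube_roots \<times> cube_roots)"
  have C: "C_theta \<theta> = of_C2 ` (?A \<union> ?B \<union> ?P \<union> ?Q)"
    unfolding C_theta_def s_def c_def by (intro arg_cong[where f = "image of_C2"]) auto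
  show "finite (C_theta \<theta>)" unfolding C by simp
  have disj1: "?A \<inter> ?B = {}" by auto
  have disj2: "(?A \<union> ?B) \<inter> ?P = {}" using s0 c0 by auto
  have disj3: "(?A \<union> ?B \<union> ?P) \<inter> ?Q = {}"
  proof -
    have "z * s \<noteq> z' * c" if "z ^ 3 = 1" "z' ^ 3 = 1" for z z'
      using sc that by (metis mult_1 power_mult_distrib)
    thus ?thesis using s0 c0 by auto
  qed
  have "(\<Sum>x\<in>C_theta \<theta>. G x) = (\<Sum>p\<in>?A \<union> ?B \<union> ?P \<union> ?Q. G (of_C2 p))"
    unfolding C by (subst sum.reindex) (auto intro: inj_on_subset[OF inj_of_C2])
  also have "\<dots> = (\<Sum>p\<in>?A. G (of_C2 p)) + (\<Sum>p\<in>?B. G (of_C2 p)) + (\<Sum>p\<in>?P. G (of_C2 p))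
      + (\<Sum>p\<in>?Q. G (of_C2 p))"
    using disj1 disj2 disj3 by (subst sum.union_disjoint; simp)+
  also have "(\<Sum>p\<in>?A. G (of_C2 p)) = torus_sum 1 0 G / 3"
    by (subst sum.reindex) (auto simp: inj_on_def torus_sum_def card_cube_roots simp flip: sum_distrib_left)
  also have "(\<Sum>p\<in>?B. G (of_C2 p)) = torus_sum 0 1 G / 3"
    by (subst sum.reindex) (auto simp: inj_on_def torus_sum_def card_cube_roots)
  also have "(\<Sum>p\<in>?P. G (of_C2 p)) = torus_sum (sin \<theta>) (cos \<theta>) G"
    using s0 c0 by (subst sum.reindex)
      (auto simp: inj_on_def torus_sum_def s_def c_def sum.cartesian_product case_prod_unfold)
  also have "(\<Sum>p\<in>?Q. G (of_C2 p)) = torus_sum (cos \<theta>) (sin \<theta>) G"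
    using s0 c0 by (subst sum.reindex)
      (auto simp: inj_on_def torus_sum_def s_def c_def sum.cartesian_product case_prod_unfold)
  finally show "(\<Sum>x\<in>C_theta \<theta>. G x) =
     torus_sum 1 0 G / 3 + torus_sum 0 1 G / 3
       + torus_sum (sin \<theta>) (cos \<theta>) G + torus_sum (cos \<theta>) (sin \<theta>) G" .
qed

lemma energy_C_theta:
  defines "s \<equiv> sin \<theta>" and "c \<equiv> cos \<theta>"
  shows "energy f (C_theta \<theta>) = 84 * f (-1/2) + 18 * f 0
    + 36 * (f s + f c) + 72 * (f (- s/2) + f (- c/2))
    + 36 * (f (s\<^sup>2 - c\<^sup>2 / 2) + f (c\<^sup>2 - s\<^sup>2 / 2))
    + 18 * (f (2 * s * c) + 4 * f (s * c / 2) + 4 * f (- (s * c)))"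
proof -
  have sc: "s * s + c * c = 1" unfolding s_def c_def by (simp flip: power2_eq_square)
  let ?g = "\<lambda>a b. f (a + b) + 2 * f (a - b / 2) + 2 * f (b - a / 2) + 4 * f (- (a + b) / 2)"
  let ?T = "\<lambda>a b. ?g a 0 / 3 + ?g 0 b / 3 + ?g (s * a) (c * b) + ?g (c * a) (s * b)"
  have T: "(\<Sum>x\<in>C_theta \<theta>. f (x \<bullet> of_C2 (z * of_real a, w * of_real b))) = ?T a b"
    if "z ^ 3 = 1" "w ^ 3 = 1" for z w a b
    unfolding sum_C_theta(2) torus_sum_inner[OF that] s_def c_def by simp
  have "(\<Sum>y\<in>C_theta \<theta>. \<Sum>x\<in>C_theta \<theta>. f (x \<bullet> y)) =
    9 * ?T 1 0 / 3 + 9 * ?T 0 1 / 3 + 9 * ?T s c + 9 * ?T c s"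
  proof -
    have "torus_sum a b (\<lambda>y. \<Sum>x\<in>C_theta \<theta>. f (x \<bullet> y)) = 9 * ?T a b" for a b
      by (rule torus_sum_const) (rule T)
    thus ?thesis unfolding sum_C_theta(2)[of "\<lambda>y. \<Sum>x\<in>C_theta \<theta>. f (x \<bullet> y)"]
      by (simp only: s_def c_def)
  qed
  moreover have "(\<Sum>y\<in>C_theta \<theta>. f (y \<bullet> y)) = 24 * f 1"
  proof -
    have "torus_sum a b (\<lambda>y. f (y \<bullet> y)) = 9 * f (a\<^sup>2 + b\<^sup>2)" for a b
      by (rule torus_sum_const) (simp add: torus_point_inner_self)
    thus ?thesis unfolding sum_C_theta(2) by simp
  qed
  ultimately have "energy f (C_theta \<theta>) =
     9 * ?T 1 0 / 3 + 9 * ?T 0 1 / 3 + 9 * ?T s c + 9 * ?T c s - 24 * f 1"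
    unfolding energy_eq_double_sum[OF sum_C_theta(1)] by (subst sum.swap) simp
  also have "\<dots> = 84 * f (-1/2) + 18 * f 0
    + 36 * (f s + f c) + 72 * (f (- s/2) + f (- c/2))
    + 36 * (f (s\<^sup>2 - c\<^sup>2 / 2) + f (c\<^sup>2 - s\<^sup>2 / 2))
    + 18 * (f (2 * s * c) + 4 * f (s * c / 2) + 4 * f (- (s * c)))"
    using sc by (simp add: field_simps power2_eq_square)
  finally show ?thesis .
qed

end

section \<open>Integer polynomials and their sign on an interval\<close>

text \<open>A polynomial is given by the list of its coefficients, the constant one first. The operations
  are plain recursive functions on integer lists, so that the simplifier can compute with
  polynomials of degree up to 30.\<close>

primrec poly_val :: "int list \<Rightarrow> real \<Rightarrow> real" where
  "poly_val [] x = 0"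
| "poly_val (a # as) x = of_int a + x * poly_val as x"

fun padd :: "int list \<Rightarrow> int list \<Rightarrow> int list" where
  "padd [] bs = bs"
| "padd as [] = as"
| "padd (a # as) (b # bs) = (a + b) # padd as bs"

definition psmult :: "int \<Rightarrow> int list \<Rightarrow> int list" where
  "psmult c as = map ((*) c) as"

primrec pmult :: "int list \<Rightarrow> int list \<Rightarrow> int list" where
  "pmult [] bs = []"
| "pmult (a # as) bs = padd (psmult a bs) (0 # pmult as bs)"

primrec ppow :: "int list \<Rightarrow> nat \<Rightarrow> int list" where
  "ppow as 0 = [1]"
| "ppow as (Suc n) = pmult as (ppow as n)"

text \<open>The polynomial \<open>a ^ n + b ^ n\<close> from \<open>e1 = a + b\<close> and \<open>e2 = a * b\<close>, by the recurrence for
  power sums. Carrying two consecutive power sums \<open>u\<close>, \<open>v\<close> avoids the exponential cost of the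
  direct two-step recursion.\<close>

primrec psums_from :: "nat \<Rightarrow> int list \<Rightarrow> int list \<Rightarrow> int list \<Rightarrow> int list \<Rightarrow> int list" where
  "psums_from 0 u v e1 e2 = u"
| "psums_from (Suc n) u v e1 e2 =
     psums_from n v (padd (pmult e1 v) (psmult (- 1) (pmult e2 u))) e1 e2"

definition psums :: "nat \<Rightarrow> int list \<Rightarrow> int list \<Rightarrow> int list" where
  "psums n e1 e2 = psums_from n [2] e1 e1 e2"

text \<open>The substitution of \<open>x / 2\<close> for \<open>x\<close>, multiplied by a power of two that keeps the
  coefficients integral.\<close>

primrec phalf :: "int list \<Rightarrow> int list" where
  "phalf [] = []"
| "phalf (a # as) = (2 ^ length (a # as) * a) # phalf as"

text \<open>A constant of its own because \<open>bs\<close> occurs twice: under innermost rewriting the recursive call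
  in \<open>pshift\<close> (the substitution of \<open>x + 1\<close> for \<open>x\<close>) is then evaluated only once.\<close>

definition pshift_step :: "int \<Rightarrow> int list \<Rightarrow> int list" where
  "pshift_step a bs = padd (a # bs) bs"

primrec pshift :: "int list \<Rightarrow> int list" where
  "pshift [] = []"
| "pshift (a # as) = pshift_step a (pshift as)"

text \<open>A lower bound on \<open>[0, 1]\<close>, obtained from the Horner scheme: multiplying a number
  that is at least \<open>L\<close> by some \<open>x\<close> in \<open>[0, 1]\<close> gives a number that is at least \<open>min 0 L\<close>.\<close>

primrec horner_bound :: "int list \<Rightarrow> int" where
  "horner_bound [] = 0"
| "horner_bound (a # as) = a + min 0 (horner_bound as)"

text \<open>If the bound is not good enough on \<open>[0, 1]\<close>, both halves of the interval are stretched to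
  \<open>[0, 1]\<close> and tested again.\<close>

primrec nonneg_by_bisection :: "nat \<Rightarrow> int list \<Rightarrow> bool" where
  "nonneg_by_bisection 0 as = (0 \<le> horner_bound as)"
| "nonneg_by_bisection (Suc n) as =
     (0 \<le> horner_bound as \<or>
       nonneg_by_bisection n (phalf as) \<and> nonneg_by_bisection n (pshift (phalf as)))"

lemma poly_val_padd [simp]: "poly_val (padd as bs) x = poly_val as x + poly_val bs x"
  by (induction as bs rule: padd.induct) (simp_all add: algebra_simps)

lemma poly_val_psmult [simp]: "poly_val (psmult c as) x = of_int c * poly_val as x"
  by (induction as) (simp_all add: psmult_def algebra_simps)

lemma poly_val_pmult [simp]: "poly_val (pmult as bs) x = poly_val as x * poly_val bs x"
  by (induction as) (simp_all add: algebra_simps)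

lemma poly_val_ppow [simp]: "poly_val (ppow as n) x = poly_val as x ^ n"
  by (induction n) simp_all

lemma poly_val_psums_from:
  assumes "poly_val e1 x = a + b" "poly_val e2 x = a * b"
  shows "poly_val u x = a ^ m + b ^ m \<Longrightarrow> poly_val v x = a ^ Suc m + b ^ Suc m \<Longrightarrow>
    poly_val (psums_from n u v e1 e2) x = a ^ (m + n) + b ^ (m + n)"
proof (induction n arbitrary: u v m)
  case (Suc n)
  have "poly_val (padd (pmult e1 v) (psmult (- 1) (pmult e2 u))) x = a ^ Suc (Suc m) + b ^ Suc (Suc m)"
    using assms Suc.prems by (simp add: algebra_simps)
  from Suc.IH[OF Suc.prems(2) this] show ?case by simp
qed simp

lemma poly_val_psums:
  assumes "poly_val e1 x = a + b" "poly_val e2 x = a * b"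
  shows "poly_val (psums n e1 e2) x = a ^ n + b ^ n"
  using poly_val_psums_from[OF assms, of "[2]" 0 e1 n] assms by (simp add: psums_def)

lemma poly_val_phalf: "poly_val (phalf as) x = 2 ^ length as * poly_val as (x / 2)"
  by (induction as) (simp_all add: algebra_simps)

lemma poly_val_pshift: "poly_val (pshift as) x = poly_val as (x + 1)"
  by (induction as) (simp_all add: pshift_step_def algebra_simps)

lemma horner_bound_le:
  assumes "0 \<le> x" "x \<le> 1"
  shows "of_int (horner_bound as) \<le> poly_val as x"
proof (induction as)
  case (Cons a as)
  have "of_int (min 0 (horner_bound as)) \<le> x * of_int (min 0 (horner_bound as))"
    using assms mult_right_mono_neg[of x 1 "of_int (min 0 (horner_bound as)) :: real"] by simp
  also have "\<dots> \<le> x * poly_val as x"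
    using assms Cons.IH by (intro mult_left_mono) auto
  finally show ?case by simp
qed simp

lemma nonneg_by_bisection_sound:
  assumes "nonneg_by_bisection n as" "0 \<le> x" "x \<le> 1"
  shows "0 \<le> poly_val as x"
  using assms
proof (induction n arbitrary: as x)
  case 0
  thus ?case using horner_bound_le[of x as] by (simp add: order_trans[rotated])
next
  case (Suc n)
  consider "0 \<le> horner_bound as"
    | "nonneg_by_bisection n (phalf as)" "nonneg_by_bisection n (pshift (phalf as))"
    using Suc.prems(1) by auto
  thus ?case
  proof cases
    case 1
    thus ?thesis using horner_bound_le[of x as] Suc.prems by (simp add: order_trans[rotated])
  next
    case 2
    have "0 \<le> poly_val (phalf as) (2 * x)"
    proof (cases "2 * x \<le> 1")
      case True
      thus ?thesis using Suc.IH[OF 2(1), of "2 * x"] Suc.prems by simp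
    next
      case False
      thus ?thesis using Suc.IH[OF 2(2), of "2 * x - 1"] Suc.prems by (simp add: poly_val_pshift)
    qed
    thus ?thesis by (simp add: poly_val_phalf zero_le_mult_iff power_le_zero_eq)
  qed
qed

section \<open>The energies as polynomials in the sine plus the cosine\<close>

definition scaled_D4_energy :: "nat \<Rightarrow> int" where
  "scaled_D4_energy k = 24 * (0 ^ k + 8 * 2 ^ k + 6 * 4 ^ k + 8 * 6 ^ k)"

text \<open>For a list \<open>p\<close> that stands for \<open>s + c\<close>, this is \<open>4 ^ k\<close> times the energy of \<open>C_theta \<theta>\<close>.
  Each summand collects inner products \<open>t\<close> through \<open>(4 + 4 * t) ^ k\<close>: the three power sums belong
  to the pairs \<open>{s, c}\<close>, \<open>{- s / 2, - c / 2}\<close> and \<open>{s\<^sup>2 - c\<^sup>2 / 2, c\<^sup>2 - s\<^sup>2 / 2}\<close>, the last three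
  powers to \<open>2 * s * c\<close>, \<open>s * c / 2\<close> and \<open>- s * c\<close>. Keeping \<open>p\<close> as a parameter allows
  a change of variable without a separate composition of polynomials.\<close>

definition energy_poly :: "nat \<Rightarrow> int list \<Rightarrow> int list" where
  "energy_poly k p =
     padd [84 * 2 ^ k + 18 * 4 ^ k]
    (padd (psmult 36 (psums k (padd [8] (psmult 4 p)) (psmult 8 (ppow (padd [1] p) 2))))
    (padd (psmult 72 (psums k (padd [8] (psmult (- 2) p)) (padd [14] (padd (psmult (- 8) p) (psmult 2 (ppow p 2))))))
    (padd (psmult 36 (psums k [10] (padd [16] (psmult 9 (ppow (padd [-1] (ppow p 2)) 2)))))
    (padd (psmult 18 (ppow (psmult 4 (ppow p 2)) k))
    (padd (psmult 72 (ppow (padd [3] (ppow p 2)) k))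
          (psmult 72 (ppow (padd [6] (psmult (- 2) (ppow p 2))) k)))))))"

definition gap_poly :: "nat \<Rightarrow> int list \<Rightarrow> int list" where
  "gap_poly k p = padd [- scaled_D4_energy k] (energy_poly k p)"

text \<open>The factor is \<open>6\<close> because the scaling by \<open>4 ^ k\<close> turns growth of the energy by \<open>3/2\<close> into
  growth by \<open>6\<close>.\<close>

definition growth_poly :: "nat \<Rightarrow> int list \<Rightarrow> int list" where
  "growth_poly k p = padd (energy_poly (Suc k) p) (psmult (- 6) (energy_poly k p))"

text \<open>For \<open>k = 3\<close> the gap is 72 times the square of a polynomial with irrational zeros, around
  which bisection would not end. So the difference from that square, namely zero, is tested
  instead.\<close>

definition gap_3_minus_square :: "int list \<Rightarrow> int list" where
  "gap_3_minus_square p = padd (gap_poly 3 p)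
     (psmult (- 72) (ppow (padd [2] (padd (psmult 9 p) (psmult (- 3) (ppow p 3)))) 2))"

text \<open>The polynomials \<open>n + x\<close> for the four unit intervals \<open>[n, n + 1]\<close> that cover \<open>[-2, 2]\<close>.\<close>

definition unit_pieces :: "int list list" where
  "unit_pieces = [[-2, 1], [-1, 1], [0, 1], [1, 1]]"

lemma scaled_D4_energy: "4 ^ k * energy (\<lambda>t. (1 + t) ^ k) C_D4 = of_int (scaled_D4_energy k)"
proof -
  have scaled: "4 ^ k * (0 :: real) ^ k = 0 ^ k"
    "4 ^ k * (1 / 2) ^ k = (2 :: real) ^ k" "4 ^ k * (3 / 2) ^ k = (6 :: real) ^ k"
    by (simp_all flip: power_mult_distrib)
  have "4 ^ k * energy (\<lambda>t. (1 + t) ^ k) C_D4 =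
      24 * (4 ^ k * 0 ^ k + 8 * (4 ^ k * (1 / 2) ^ k) + 6 * 4 ^ k + 8 * (4 ^ k * (3 / 2) ^ k))"
    unfolding energy_C_D4 by (simp add: algebra_simps)
  thus ?thesis unfolding scaled scaled_D4_energy_def by simp
qed

lemma poly_val_energy_poly:
  assumes \<theta>: "sin (2 * \<theta>) \<noteq> 0" "sin \<theta> \<noteq> cos \<theta>"
    and p: "poly_val p x = sin \<theta> + cos \<theta>"
  shows "poly_val (energy_poly k p) x = 4 ^ k * energy (\<lambda>t. (1 + t) ^ k) (C_theta \<theta>)"
proof -
  define s c where "s = sin \<theta>" and "c = cos \<theta>"
  have sc: "s\<^sup>2 + c\<^sup>2 = 1" unfolding s_def c_def by simp
  hence c2: "c\<^sup>2 = 1 - s\<^sup>2" by simp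
  have px: "poly_val p x = s + c" unfolding s_def c_def by (rule p)
  have sq: "(s + c)\<^sup>2 = 1 + 2 * s * c" using sc by (simp add: power2_sum)
  have sq': "8 * (1 + (s + c))\<^sup>2 = (4 + 4 * s) * (4 + 4 * c)" using sc by (simp add: power2_eq_square algebra_simps)
  have sq'': "14 - 8 * (s + c) + 2 * (s + c)\<^sup>2 = (4 + 4 * (- s / 2)) * (4 + 4 * (- c / 2))"
    unfolding sq by (simp add: algebra_simps)
  have scale: "4 ^ k * (1 + t) ^ k = (4 + 4 * t) ^ k" for t :: real
    by (simp add: flip: power_mult_distrib)
  have 1: "poly_val (psums k (padd [8] (psmult 4 p)) (psmult 8 (ppow (padd [1] p) 2))) x =
      (4 + 4 * s) ^ k + (4 + 4 * c) ^ k"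
    by (rule poly_val_psums) (simp_all add: px sq')
  have 2: "poly_val (psums k (padd [8] (psmult (- 2) p))
        (padd [14] (padd (psmult (- 8) p) (psmult 2 (ppow p 2))))) x =
      (4 + 4 * (- s / 2)) ^ k + (4 + 4 * (- c / 2)) ^ k"
    by (rule poly_val_psums) (simp add: px, use sq'' in \<open>simp add: px algebra_simps\<close>)
  have 3: "poly_val (psums k [10] (padd [16] (psmult 9 (ppow (padd [-1] (ppow p 2)) 2)))) x =
      (4 + 4 * (s\<^sup>2 - c\<^sup>2 / 2)) ^ k + (4 + 4 * (c\<^sup>2 - s\<^sup>2 / 2)) ^ k"
  proof (rule poly_val_psums)
    show "poly_val [10] x = 4 + 4 * (s\<^sup>2 - c\<^sup>2 / 2) + (4 + 4 * (c\<^sup>2 - s\<^sup>2 / 2))"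
      using sc by (simp add: field_simps)
    have "(4 + 4 * (s\<^sup>2 - c\<^sup>2 / 2)) * (4 + 4 * (c\<^sup>2 - s\<^sup>2 / 2)) = 16 + 36 * (s\<^sup>2 * c\<^sup>2)"
      unfolding c2 by (simp add: field_simps)
    thus "poly_val (padd [16] (psmult 9 (ppow (padd [-1] (ppow p 2)) 2))) x =
        (4 + 4 * (s\<^sup>2 - c\<^sup>2 / 2)) * (4 + 4 * (c\<^sup>2 - s\<^sup>2 / 2))"
      by (simp add: px sq power_mult_distrib)
  qed
  have 4: "4 * (s + c)\<^sup>2 = 4 + 4 * (2 * s * c)" "3 + (s + c)\<^sup>2 = 4 + 4 * (s * c / 2)"
    "6 - 2 * (s + c)\<^sup>2 = 4 + 4 * (- (s * c))"
    unfolding sq by simp_all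
  have "4 ^ k * energy (\<lambda>t. (1 + t) ^ k) (C_theta \<theta>) =
      84 * (4 + 4 * (-1/2)) ^ k + 18 * (4 + 4 * 0) ^ k
      + 36 * ((4 + 4 * s) ^ k + (4 + 4 * c) ^ k)
      + 72 * ((4 + 4 * (- s / 2)) ^ k + (4 + 4 * (- c / 2)) ^ k)
      + 36 * ((4 + 4 * (s\<^sup>2 - c\<^sup>2 / 2)) ^ k + (4 + 4 * (c\<^sup>2 - s\<^sup>2 / 2)) ^ k)
      + 18 * ((4 + 4 * (2 * s * c)) ^ k + 4 * (4 + 4 * (s * c / 2)) ^ k + 4 * (4 + 4 * (- (s * c))) ^ k)"
    unfolding energy_C_theta[OF \<theta>, folded s_def c_def] scale[symmetric] by (simp only: algebra_simps)
  also have "\<dots> = poly_val (energy_poly k p) x"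
    unfolding energy_poly_def poly_val_padd poly_val_psmult poly_val_ppow 1 2 3 px
    unfolding 4[symmetric] by simp
  finally show ?thesis ..
qed

lemma poly_val_gap_poly:
  assumes "sin (2 * \<theta>) \<noteq> 0" "sin \<theta> \<noteq> cos \<theta>" "poly_val p x = sin \<theta> + cos \<theta>"
  shows "poly_val (gap_poly k p) x =
    4 ^ k * (energy (\<lambda>t. (1 + t) ^ k) (C_theta \<theta>) - energy (\<lambda>t. (1 + t) ^ k) C_D4)"
  by (simp add: gap_poly_def poly_val_energy_poly[OF assms] right_diff_distrib scaled_D4_energy)

text \<open>Since \<open>\<bar>s + c\<bar> \<le> sqrt 2 < 2\<close>, the number \<open>s + c\<close> lies in a unit interval that starts at
  \<open>-2\<close>, \<open>-1\<close>, \<open>0\<close> or \<open>1\<close>.\<close>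

lemma nonneg_on_circle:
  assumes check: "list_all (nonneg_by_bisection d) (map P unit_pieces)"
    and val: "\<And>p x. poly_val p x = sin \<theta> + cos \<theta> \<Longrightarrow> poly_val (P p) x = v"
  shows "0 \<le> v"
proof -
  define q n where "q = sin \<theta> + cos \<theta>" and "n = \<lfloor>q\<rfloor>"
  have "q\<^sup>2 + (sin \<theta> - cos \<theta>)\<^sup>2 = 2"
    using sin_cos_squared_add[of \<theta>] unfolding q_def by (simp add: power2_eq_square algebra_simps)
  hence "q\<^sup>2 \<le> 2" using zero_le_power2[of "sin \<theta> - cos \<theta>"] by linarith
  hence "q\<^sup>2 < 2\<^sup>2" by simp
  hence "\<bar>q\<bar> < 2" using power2_less_imp_less[of "\<bar>q\<bar>" 2] by simp
  hence "n \<in> {-2, -1, 0, 1}" unfolding n_def by (simp; linarith)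
  hence "nonneg_by_bisection d (P [n, 1])" using check by (auto simp: unit_pieces_def)
  moreover have "0 \<le> q - n" "q - n \<le> 1" unfolding n_def by linarith+
  ultimately have "0 \<le> poly_val (P [n, 1]) (q - n)" by (rule nonneg_by_bisection_sound)
  also have "poly_val (P [n, 1]) (q - n) = v" by (rule val) (simp add: q_def)
  finally show ?thesis .
qed

section \<open>Growth in the exponent\<close>

text \<open>The energy at exponent \<open>k + 1\<close> minus \<open>r\<close> times the energy at exponent \<open>k\<close> is the sum of
  \<open>w ^ k * (w - r)\<close> with \<open>w = 1 + t\<close> over the inner products \<open>t\<close>. Replacing \<open>w ^ (k - m)\<close> by
  \<open>r ^ (k - m)\<close> does not increase any term, whether \<open>w\<close> is above or below \<open>r\<close>, and leaves a
  multiple of the same sum at exponent \<open>m\<close>.\<close>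

lemma energy_growth:
  assumes C: "\<And>x. x \<in> C \<Longrightarrow> x \<bullet> x = 1"
    and r: "0 \<le> r" and "m \<le> k"
    and base: "r * energy (\<lambda>t. (1 + t) ^ m) C \<le> energy (\<lambda>t. (1 + t) ^ Suc m) C"
  shows "r * energy (\<lambda>t. (1 + t) ^ k) C \<le> energy (\<lambda>t. (1 + t) ^ Suc k) C"
proof -
  let ?S = "{(c, c'). c \<in> C \<and> c' \<in> C \<and> c \<noteq> c'}"
  have diff: "energy (\<lambda>t. (1 + t) ^ Suc j) C - r * energy (\<lambda>t. (1 + t) ^ j) C =
      (\<Sum>(c, c')\<in>?S. (1 + c \<bullet> c') ^ j * (1 + c \<bullet> c' - r))" for j
    unfolding energy_def sum_distrib_left sum_subtractf[symmetric]
    by (intro sum.cong refl) (simp add: case_prod_unfold algebra_simps)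
  have pow: "r ^ (k - m) * (w ^ m * (w - r)) \<le> w ^ k * (w - r)" if "0 \<le> w" for w :: real
  proof -
    have "0 \<le> (w ^ (k - m) - r ^ (k - m)) * (w - r)"
      using that r by (cases "r \<le> w") (auto simp: zero_le_mult_iff intro: power_mono)
    hence "0 \<le> w ^ m * ((w ^ (k - m) - r ^ (k - m)) * (w - r))" using that by simp
    also have "\<dots> = w ^ (m + (k - m)) * (w - r) - r ^ (k - m) * (w ^ m * (w - r))"
      by (simp add: power_add algebra_simps)
    finally show ?thesis using \<open>m \<le> k\<close> by simp
  qed
  have nn: "0 \<le> 1 + c \<bullet> c'" if "c \<in> C" "c' \<in> C" for c c'
  proof -
    have "\<bar>c \<bullet> c'\<bar> \<le> norm c * norm c'" by (rule Cauchy_Schwarz_ineq2)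
    thus ?thesis using C[OF that(1)] C[OF that(2)] by (simp add: norm_eq_sqrt_inner)
  qed
  have "0 \<le> r ^ (k - m) * (\<Sum>(c, c')\<in>?S. (1 + c \<bullet> c') ^ m * (1 + c \<bullet> c' - r))"
    using r base diff[of m] by simp
  also have "\<dots> \<le> (\<Sum>(c, c')\<in>?S. (1 + c \<bullet> c') ^ k * (1 + c \<bullet> c' - r))"
    unfolding sum_distrib_left using pow nn by (intro sum_mono) auto
  finally show ?thesis using diff[of k] by simp
qed

lemma energy_C_D4_Suc_le:
  "energy (\<lambda>t. (1 + t) ^ Suc k) C_D4 \<le> 3 / 2 * energy (\<lambda>t. (1 + t) ^ k) C_D4"
proof -
  have "0 \<le> (1 / 2 :: real) ^ k" "0 \<le> (0 :: real) ^ k" by simp_all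
  thus ?thesis unfolding energy_C_D4 by (simp add: algebra_simps)
qed

section \<open>The sign of the energy gap\<close>

text \<open>The depths 9 and 10 are numbers of bisections that suffice. The tests are stated for numerals
  and without bound variables, so that rewriting only meets ground terms.\<close>

lemma gap_nonneg_small_exponents:
  "list_all (nonneg_by_bisection 9) (map (gap_poly 0) unit_pieces)"
  "list_all (nonneg_by_bisection 9) (map (gap_poly 1) unit_pieces)"
  "list_all (nonneg_by_bisection 9) (map (gap_poly 2) unit_pieces)"
  "list_all (nonneg_by_bisection 9) (map (gap_poly 4) unit_pieces)"
  "list_all (nonneg_by_bisection 9) (map (gap_poly 5) unit_pieces)"
  "list_all (nonneg_by_bisection 9) (map (gap_poly 6) unit_pieces)"
  "list_all (nonneg_by_bisection 9) (map (gap_poly 7) unit_pieces)"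
  by code_simp+

lemma gap_3_minus_square_nonneg: "list_all (nonneg_by_bisection 0) (map gap_3_minus_square unit_pieces)"
  by code_simp

lemma gap_14_nonneg:
  "list_all (nonneg_by_bisection 10) (map (gap_poly 14) unit_pieces)"
  by code_simp

lemma growth_from_14_nonneg: "list_all (nonneg_by_bisection 10) (map (growth_poly 14) unit_pieces)"
  by code_simp

text \<open>With \<open>p = - x\<close>, two halvings bring the value at \<open>p = -1/4\<close> to \<open>x = 1\<close>, where it is the sum of
  the coefficients, up to a power of two. The six gaps have their minima between \<open>p = -0.261\<close> and
  \<open>p = -0.243\<close>, close enough together for this one value of \<open>p\<close> to serve all of them.\<close>

lemma gap_negative_at_minus_quarter:
  "sum_list (phalf (phalf (gap_poly 8 [0, -1]))) < 0"
  "sum_list (phalf (phalf (gap_poly 9 [0, -1]))) < 0"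
  "sum_list (phalf (phalf (gap_poly 10 [0, -1]))) < 0"
  "sum_list (phalf (phalf (gap_poly 11 [0, -1]))) < 0"
  "sum_list (phalf (phalf (gap_poly 12 [0, -1]))) < 0"
  "sum_list (phalf (phalf (gap_poly 13 [0, -1]))) < 0"
  by code_simp+

lemma C_D4_le_C_theta_base:
  assumes \<theta>: "sin (2 * \<theta>) \<noteq> 0" "sin \<theta> \<noteq> cos \<theta>" and k: "k < 8 \<or> k = 14"
  shows "energy (\<lambda>t. (1 + t) ^ k) C_D4 \<le> energy (\<lambda>t. (1 + t) ^ k) (C_theta \<theta>)"
proof -
  let ?gap = "energy (\<lambda>t. (1 + t) ^ k) (C_theta \<theta>) - energy (\<lambda>t. (1 + t) ^ k) C_D4"
  have "0 \<le> 4 ^ k * ?gap"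
  proof (cases "k = 3")
    case True
    let ?q = "sin \<theta> + cos \<theta>"
    have "0 \<le> 4 ^ k * ?gap - 72 * (2 + 9 * ?q - 3 * ?q ^ 3)\<^sup>2"
      by (rule nonneg_on_circle[where \<theta> = \<theta>, OF gap_3_minus_square_nonneg])
        (simp add: gap_3_minus_square_def poly_val_gap_poly[OF \<theta>] True add_diff_eq)
    moreover have "0 \<le> 72 * (2 + 9 * ?q - 3 * ?q ^ 3)\<^sup>2" by simp
    ultimately show ?thesis by linarith
  next
    case False
    have "\<exists>d. list_all (nonneg_by_bisection d) (map (gap_poly k) unit_pieces)"
    proof (cases "k = 14")
      case True
      thus ?thesis using gap_14_nonneg by blast
    next
      case k14: False
      have "k = 0 \<or> k = 1 \<or> k = 2 \<or> k = 4 \<or> k = 5 \<or> k = 6 \<or> k = 7" using k k14 False by auto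
      thus ?thesis using gap_nonneg_small_exponents by blast
    qed
    then obtain d where "list_all (nonneg_by_bisection d) (map (gap_poly k) unit_pieces)" by blast
    thus ?thesis by (rule nonneg_on_circle) (rule poly_val_gap_poly[OF \<theta>])
  qed
  thus ?thesis by (simp add: zero_le_mult_iff power_le_zero_eq)
qed

lemma C_theta_growth:
  assumes \<theta>: "sin (2 * \<theta>) \<noteq> 0" "sin \<theta> \<noteq> cos \<theta>" and "14 \<le> k"
  shows "3 / 2 * energy (\<lambda>t. (1 + t) ^ k) (C_theta \<theta>) \<le> energy (\<lambda>t. (1 + t) ^ Suc k) (C_theta \<theta>)"
proof (rule energy_growth)
  let ?E = "\<lambda>k. energy (\<lambda>t. (1 + t) ^ k) (C_theta \<theta>)"
  have "0 \<le> 4 ^ 15 * ?E 15 - 6 * (4 ^ 14 * ?E 14)"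
    by (rule nonneg_on_circle[where \<theta> = \<theta>, OF growth_from_14_nonneg])
      (simp add: growth_poly_def poly_val_energy_poly[OF \<theta>])
  thus "3 / 2 * ?E 14 \<le> ?E (Suc 14)" by simp
qed (use assms C_theta_unit in auto)

lemma C_D4_le_C_theta_large:
  assumes \<theta>: "sin (2 * \<theta>) \<noteq> 0" "sin \<theta> \<noteq> cos \<theta>" and "14 \<le> k"
  shows "energy (\<lambda>t. (1 + t) ^ k) C_D4 \<le> energy (\<lambda>t. (1 + t) ^ k) (C_theta \<theta>)"
  using \<open>14 \<le> k\<close>
proof (induction k rule: dec_induct)
  case base
  show ?case using C_D4_le_C_theta_base[OF \<theta>] by blast
next
  case (step k)
  thus ?case
    using energy_C_D4_Suc_le[of k] C_theta_growth[OF \<theta>, of k] by linarith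
qed

lemma C_theta_less_C_D4:
  assumes \<theta>: "sin (2 * \<theta>) \<noteq> 0" "sin \<theta> \<noteq> cos \<theta>" and sum: "sin \<theta> + cos \<theta> = - 1 / 4"
    and k: "8 \<le> k" "k \<le> 13"
  shows "energy (\<lambda>t. (1 + t) ^ k) (C_theta \<theta>) < energy (\<lambda>t. (1 + t) ^ k) C_D4"
proof -
  have val1: "poly_val as 1 = of_int (sum_list as)" for as by (induction as) simp_all
  let ?p = "gap_poly k [0, -1]"
  have "k = 8 \<or> k = 9 \<or> k = 10 \<or> k = 11 \<or> k = 12 \<or> k = 13" using k by linarith
  hence "sum_list (phalf (phalf ?p)) < 0" using gap_negative_at_minus_quarter by blast
  hence "poly_val (phalf (phalf ?p)) 1 < 0" unfolding val1 by simp
  hence "poly_val ?p (1 / 4) < 0" by (simp add: poly_val_phalf mult_less_0_iff)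
  also have "poly_val ?p (1 / 4) = 4 ^ k * (energy (\<lambda>t. (1 + t) ^ k) (C_theta \<theta>)
      - energy (\<lambda>t. (1 + t) ^ k) C_D4)"
    using sum by (intro poly_val_gap_poly[OF \<theta>]) simp
  finally show ?thesis by (simp add: mult_less_0_iff)
qed

lemma exists_angle_sin_plus_cos:
  "\<exists>\<theta>. sin (2 * \<theta>) \<noteq> 0 \<and> sin \<theta> \<noteq> cos \<theta> \<and> sin \<theta> + cos \<theta> = (- 1 / 4 :: real)"
proof -
  have "\<exists>\<theta>\<ge>pi / 2. \<theta> \<le> pi \<and> sin \<theta> + cos \<theta> = - 1 / 4"
    by (rule IVT2') (auto intro!: continuous_intros)
  then obtain \<theta> :: real where \<theta>: "sin \<theta> + cos \<theta> = - 1 / 4" by blast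
  have "1 + sin (2 * \<theta>) = (sin \<theta> + cos \<theta>)\<^sup>2"
    using sin_cos_squared_add[of \<theta>] by (simp add: power2_sum sin_double)
  hence "sin (2 * \<theta>) \<noteq> 0" unfolding \<theta> by (simp add: power2_eq_square)
  moreover have "sin \<theta> \<noteq> cos \<theta>"
  proof
    assume "sin \<theta> = cos \<theta>"
    hence "sin \<theta> = - 1 / 8" "cos \<theta> = - 1 / 8" using \<theta> by auto
    thus False using sin_cos_squared_add[of \<theta>] by (simp add: power2_eq_square)
  qed
  ultimately show ?thesis using \<theta> by blast
qed

theorem proposition3p1:
  shows "(\<forall>k::nat. 8 \<le> k \<and> k \<le> 13 \<longrightarrow>
            (\<exists>\<theta>::real. sin (2 * \<theta>) \<noteq> 0 \<and> sin \<theta> \<noteq> cos \<theta> \<and>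
               energy (\<lambda>t. (1 + t) ^ k) (C_theta \<theta>) < energy (\<lambda>t. (1 + t) ^ k) C_D4))
       \<and> (\<forall>k::nat. \<not> (8 \<le> k \<and> k \<le> 13) \<longrightarrow>
            \<not> (\<exists>\<theta>::real. sin (2 * \<theta>) \<noteq> 0 \<and> sin \<theta> \<noteq> cos \<theta> \<and>
               energy (\<lambda>t. (1 + t) ^ k) (C_theta \<theta>) < energy (\<lambda>t. (1 + t) ^ k) C_D4))"
proof (intro conjI allI impI notI)
  fix k :: nat assume "8 \<le> k \<and> k \<le> 13"
  thus "\<exists>\<theta>::real. sin (2 * \<theta>) \<noteq> 0 \<and> sin \<theta> \<noteq> cos \<theta> \<and>
      energy (\<lambda>t. (1 + t) ^ k) (C_theta \<theta>) < energy (\<lambda>t. (1 + t) ^ k) C_D4"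
    using exists_angle_sin_plus_cos C_theta_less_C_D4 by blast
next
  fix k :: nat assume k: "\<not> (8 \<le> k \<and> k \<le> 13)"
  assume "\<exists>\<theta>::real. sin (2 * \<theta>) \<noteq> 0 \<and> sin \<theta> \<noteq> cos \<theta> \<and>
      energy (\<lambda>t. (1 + t) ^ k) (C_theta \<theta>) < energy (\<lambda>t. (1 + t) ^ k) C_D4"
  then obtain \<theta> :: real where \<theta>: "sin (2 * \<theta>) \<noteq> 0" "sin \<theta> \<noteq> cos \<theta>"
    and less: "energy (\<lambda>t. (1 + t) ^ k) (C_theta \<theta>) < energy (\<lambda>t. (1 + t) ^ k) C_D4" by blast
  have "k < 8 \<or> 14 \<le> k" using k by linarith
  thus False
    using C_D4_le_C_theta_base[OF \<theta>, of k] C_D4_le_C_theta_large[OF \<theta>, of k] less by linarith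
qed

end
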